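(* Let $\mathbf{k}$ be a field and let $(L,+,\langle\,,\,\rangle,[\,,\,])$ be a simple Hu-Liu Leibniz algebra over $\mathbf{k}$ such that $[L^{ann},L]\neq 0$. Then $L$ is linear; that is, there exist a special $\mathcal{Z}_2$-graded associative algebra $A=A_0\oplus A_1$ over $\mathbf{k}$ and an injective homomorphism of Hu-Liu Leibniz algebras from $L$ to $(A,+,\langle\,,\,\rangle,[\,,\,])$, where the brackets on $A$ are $\langle x,y\rangle:=xy_0-y_0x$ and $[x,y]:=xy-yx$ for $x\in A$, $y=y_0+y_1\in A$, $y_i\in A_i$ ($i=0,1$).
   Context: A right Leibniz algebra over a field $\mathbf{k}$ is a $\mathbf{k}$-vector space $L$ with a bilinear operation $\langle\,,\,\rangle: L\times L\to L$ (the angle bracket) satisfying $\langle\langle x,y\rangle,z\rangle=\langle x,\langle y,z\rangle\rangle+\langle\langle x,z\rangle,y\rangle$ for all $x,y,z\in L$. Its annihilator is $L^{ann}:=\sum_{x\in L}\mathbf{k}\langle x,x\rangle$. A (right) Hu-Liu Leibniz algebra $(L,+,\langle\,,\,\rangle,[\,,\,])$ is a right Leibniz algebra $(L,+,\langle\,,\,\rangle)$ together with an operation $[\,,\,]:L\times L\to L$ (the square bracket) such that $(L,+,[\,,\,])$ is a Lie algebra and, for all $x,y,z\in L$: (1) $\langle x,[y,z]\rangle=\langle x,\langle y,z\rangle\rangle$; (2) $[\langle x,x\rangle,y]=\langle\langle x,x\rangle,y\rangle$; (3) $\langle[x,y],z\rangle+[\langle y,z\rangle,x]+[y,\langle x,z\rangle]=0$;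 (4) $[\langle x,y\rangle,z]+[z,[x,y]]+[z,\langle y,x\rangle]+\langle z,\langle x,y\rangle\rangle=0$. A subspace $I$ of a Hu-Liu Leibniz algebra $L$ is an ideal if $\langle I,L\rangle\subseteq I$, $\langle L,I\rangle\subseteq I$ and $[L,I]\subseteq I$; the subspace $L^{ann}$ is an ideal. A Hu-Liu Leibniz algebra $L$ is simple if $L^{ann}\neq0$ and $L$ has no ideals other than $\{0\}$, $L^{ann}$ and $L$. A homomorphism $\phi:L\to\bar L$ of Hu-Liu Leibniz algebras is a linear map with $\phi(\langle x,y\rangle)=\langle\phi(x),\phi(y)\rangle$ and $\phi([x,y])=[\phi(x),\phi(y)]$ for all $x,y\in L$. Associative algebras are not assumed to have an identity. An associative algebra $A$ is called a special $\mathcal{Z}_2$-graded associative algebra if $A=A_0\oplus A_1$ as vector spaces and $A_0A_0\subseteq A_0$, $A_0A_1+A_1A_0\subseteq A_1$, and $A_1A_1=0$. For such $A$, the two brackets given in the claim make $A$ a Hu-Liu Leibniz algebra. *)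

theory Defs
  imports Complex_Main "HOL-Library.Function_Algebras" "HOL-Library.Product_Plus"
begin

locale bilinear_operation = vector_space scale
  for scale :: "'k::field \<Rightarrow> 'a::ab_group_add \<Rightarrow> 'a" +
  fixes mult :: "'a \<Rightarrow> 'a \<Rightarrow> 'a"
  assumes linear_left: "Vector_Spaces.linear scale scale (\<lambda>x. mult x y)"
    and linear_right: "Vector_Spaces.linear scale scale (\<lambda>y. mult x y)"
begin

lemma mult_add_left: "mult (x + x') y = mult x y + mult x' y"
  by (rule module_hom.add[OF linear_left[folded module_hom_iff_linear]])

lemma mult_add_right: "mult x (y + y') = mult x y + mult x y'"
  by (rule module_hom.add[OF linear_right[folded module_hom_iff_linear]])

lemma mult_scale_left: "mult (scale c x) y = scale c (mult x y)"
  by (rule module_hom.scale[OF linear_left[folded module_hom_iff_linear]])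

lemma mult_scale_right: "mult x (scale c y) = scale c (mult x y)"
  by (rule module_hom.scale[OF linear_right[folded module_hom_iff_linear]])

lemma mult_diff_left: "mult (x - x') y = mult x y - mult x' y"
  by (rule module_hom.diff[OF linear_left[folded module_hom_iff_linear]])

lemma mult_diff_right: "mult x (y - y') = mult x y - mult x y'"
  by (rule module_hom.diff[OF linear_right[folded module_hom_iff_linear]])

end

locale right_leibniz_algebra = bilinear_operation scale angle
  for scale :: "'k::field \<Rightarrow> 'a::ab_group_add \<Rightarrow> 'a"
    and angle :: "'a \<Rightarrow> 'a \<Rightarrow> 'a" +
  assumes leibniz_identity:
    "angle (angle x y) z = angle x (angle y z) + angle (angle x z) y"
begin

definition annihilator :: "'a set" where
  "annihilator = span (range (\<lambda>x. angle x x))"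

end

locale lie_algebra = bilinear_operation scale square
  for scale :: "'k::field \<Rightarrow> 'a::ab_group_add \<Rightarrow> 'a"
    and square :: "'a \<Rightarrow> 'a \<Rightarrow> 'a" +
  assumes alternating: "square x x = 0"
    and jacobi: "square x (square y z) + square y (square z x) + square z (square x y) = 0"

locale hu_liu_leibniz_algebra =
  right_leibniz_algebra scale angle + lie: lie_algebra scale square
  for scale :: "'k::field \<Rightarrow> 'a::ab_group_add \<Rightarrow> 'a"
    and angle square :: "'a \<Rightarrow> 'a \<Rightarrow> 'a" +
  assumes hu_liu_1: "angle x (square y z) = angle x (angle y z)"
    and hu_liu_2: "square (angle x x) y = angle (angle x x) y"
    and hu_liu_3: "angle (square x y) z + square (angle y z) x + square y (angle x z) = 0"
    and hu_liu_4: "square (angle x y) z + square z (square x y)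
      + square z (angle y x) + angle z (angle x y) = 0"
begin

definition hu_liu_ideal :: "'a set \<Rightarrow> bool" where
  "hu_liu_ideal I \<longleftrightarrow> subspace I \<and>
    (\<forall>a\<in>I. \<forall>x. angle a x \<in> I \<and> angle x a \<in> I \<and> square x a \<in> I)"

definition square_product :: "'a set \<Rightarrow> 'a set \<Rightarrow> 'a set" where
  "square_product U V = span {square u v | u v. u \<in> U \<and> v \<in> V}"

end

locale simple_hu_liu_leibniz_algebra = hu_liu_leibniz_algebra scale angle square
  for scale :: "'k::field \<Rightarrow> 'a::ab_group_add \<Rightarrow> 'a"
    and angle square :: "'a \<Rightarrow> 'a \<Rightarrow> 'a" +
  assumes annihilator_nonzero: "annihilator \<noteq> {0}"
    and ideals_trivial: "hu_liu_ideal I \<Longrightarrow> I = {0} \<or> I = annihilator \<or> I = UNIV"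

locale hu_liu_homomorphism =
  source: hu_liu_leibniz_algebra scale\<^sub>1 angle\<^sub>1 square\<^sub>1 +
  target: hu_liu_leibniz_algebra scale\<^sub>2 angle\<^sub>2 square\<^sub>2
  for scale\<^sub>1 :: "'k::field \<Rightarrow> 'a::ab_group_add \<Rightarrow> 'a"
    and angle\<^sub>1 square\<^sub>1 :: "'a \<Rightarrow> 'a \<Rightarrow> 'a"
    and scale\<^sub>2 :: "'k \<Rightarrow> 'b::ab_group_add \<Rightarrow> 'b"
    and angle\<^sub>2 square\<^sub>2 :: "'b \<Rightarrow> 'b \<Rightarrow> 'b" +
  fixes \<phi> :: "'a \<Rightarrow> 'b"
  assumes linear: "Vector_Spaces.linear scale\<^sub>1 scale\<^sub>2 \<phi>"
    and map_angle: "\<phi> (angle\<^sub>1 x y) = angle\<^sub>2 (\<phi> x) (\<phi> y)"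
    and map_square: "\<phi> (square\<^sub>1 x y) = square\<^sub>2 (\<phi> x) (\<phi> y)"

text \<open>Associative algebras are not required to have an identity element. Since HOL cannot quantify
  existentially over types, an existence claim about such algebras has to name the type carrying
  the witness. For an algebra \<open>L\<close> on the type \<open>'a\<close> we use the additive group
  \<open>('a \<Rightarrow> 'a) \<times> 'a\<close>, with pointwise addition, which has room for \<open>End(L) \<oplus> L\<close>;
  any unused part can be placed in \<open>A\<^sub>0\<close> with zero multiplication.\<close>

locale associative_algebra = bilinear_operation scale mult
  for scale :: "'k::field \<Rightarrow> 'a::ab_group_add \<Rightarrow> 'a"
    and mult :: "'a \<Rightarrow> 'a \<Rightarrow> 'a" +
  assumes mult_assoc: "mult (mult x y) z = mult x (mult y z)"

locale special_Z2_graded_algebra = associative_algebra scale mult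
  for scale :: "'k::field \<Rightarrow> 'a::ab_group_add \<Rightarrow> 'a"
    and mult :: "'a \<Rightarrow> 'a \<Rightarrow> 'a" +
  fixes A\<^sub>0 A\<^sub>1 :: "'a set"
  assumes subspace_even: "subspace A\<^sub>0"
    and subspace_odd: "subspace A\<^sub>1"
    and even_inter_odd: "A\<^sub>0 \<inter> A\<^sub>1 = {0}"
    and even_plus_odd: "\<exists>x\<^sub>0\<in>A\<^sub>0. \<exists>x\<^sub>1\<in>A\<^sub>1. x = x\<^sub>0 + x\<^sub>1"
    and even_even: "\<lbrakk>x \<in> A\<^sub>0; y \<in> A\<^sub>0\<rbrakk> \<Longrightarrow> mult x y \<in> A\<^sub>0"
    and even_odd: "\<lbrakk>x \<in> A\<^sub>0; y \<in> A\<^sub>1\<rbrakk> \<Longrightarrow> mult x y \<in> A\<^sub>1"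
    and odd_even: "\<lbrakk>x \<in> A\<^sub>1; y \<in> A\<^sub>0\<rbrakk> \<Longrightarrow> mult x y \<in> A\<^sub>1"
    and odd_odd: "\<lbrakk>x \<in> A\<^sub>1; y \<in> A\<^sub>1\<rbrakk> \<Longrightarrow> mult x y = 0"

text \<open>The component \<open>y\<^sub>0\<close> of \<open>y = y\<^sub>0 + y\<^sub>1\<close>; it is only meaningful when
  \<open>A\<^sub>0\<close> and \<open>A\<^sub>1\<close> are complementary subspaces.\<close>

definition even_part :: "'a::ab_group_add set \<Rightarrow> 'a set \<Rightarrow> 'a \<Rightarrow> 'a" where
  "even_part A\<^sub>0 A\<^sub>1 y = (THE y\<^sub>0. y\<^sub>0 \<in> A\<^sub>0 \<and> (\<exists>y\<^sub>1\<in>A\<^sub>1. y = y\<^sub>0 + y\<^sub>1))"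

definition graded_angle ::
    "('a::ab_group_add \<Rightarrow> 'a \<Rightarrow> 'a) \<Rightarrow> 'a set \<Rightarrow> 'a set \<Rightarrow> 'a \<Rightarrow> 'a \<Rightarrow> 'a" where
  "graded_angle mult A\<^sub>0 A\<^sub>1 x y = mult x (even_part A\<^sub>0 A\<^sub>1 y) - mult (even_part A\<^sub>0 A\<^sub>1 y) x"

definition commutator :: "('a::ab_group_add \<Rightarrow> 'a \<Rightarrow> 'a) \<Rightarrow> 'a \<Rightarrow> 'a \<Rightarrow> 'a" where
  "commutator mult x y = mult x y - mult y x"

context special_Z2_graded_algebra
begin

lemma even_part_eqI:
  assumes "a \<in> A\<^sub>0" "b \<in> A\<^sub>1" "y = a + b"
  shows "even_part A\<^sub>0 A\<^sub>1 y = a"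
  unfolding even_part_def
proof (rule the_equality)
  show "a \<in> A\<^sub>0 \<and> (\<exists>y\<^sub>1\<in>A\<^sub>1. y = a + y\<^sub>1)" using assms by blast
next
  fix c assume "c \<in> A\<^sub>0 \<and> (\<exists>y\<^sub>1\<in>A\<^sub>1. y = c + y\<^sub>1)"
  then obtain d where c: "c \<in> A\<^sub>0" and d: "d \<in> A\<^sub>1" and y: "y = c + d" by blast
  have "c - a \<in> A\<^sub>0" using c assms subspace_even by (simp add: subspace_diff)
  moreover have "c - a = b - d" using y assms(3) by (simp add: algebra_simps)
  moreover have "b - d \<in> A\<^sub>1" using d assms subspace_odd by (simp add: subspace_diff)
  ultimately have "c - a \<in> A\<^sub>0 \<inter> A\<^sub>1" by simp
  then show "c = a" using even_inter_odd by simp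
qed

lemma even_part_mem: "even_part A\<^sub>0 A\<^sub>1 y \<in> A\<^sub>0"
  and odd_part_mem: "y - even_part A\<^sub>0 A\<^sub>1 y \<in> A\<^sub>1"
proof -
  obtain a b where *: "a \<in> A\<^sub>0" "b \<in> A\<^sub>1" "y = a + b" using even_plus_odd by blast
  then have "even_part A\<^sub>0 A\<^sub>1 y = a" by (rule even_part_eqI)
  with * show "even_part A\<^sub>0 A\<^sub>1 y \<in> A\<^sub>0" "y - even_part A\<^sub>0 A\<^sub>1 y \<in> A\<^sub>1" by simp_all
qed

lemma even_part_add: "even_part A\<^sub>0 A\<^sub>1 (x + y) = even_part A\<^sub>0 A\<^sub>1 x + even_part A\<^sub>0 A\<^sub>1 y"
  by (rule even_part_eqI[where b = "(x - even_part A\<^sub>0 A\<^sub>1 x) + (y - even_part A\<^sub>0 A\<^sub>1 y)"])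
    (auto intro!: subspace_add subspace_even subspace_odd even_part_mem odd_part_mem)

lemma even_part_scale: "even_part A\<^sub>0 A\<^sub>1 (scale c x) = scale c (even_part A\<^sub>0 A\<^sub>1 x)"
  by (rule even_part_eqI[where b = "scale c (x - even_part A\<^sub>0 A\<^sub>1 x)"])
    (auto intro!: subspace_scale subspace_even subspace_odd even_part_mem odd_part_mem
      simp flip: scale_right_distrib)

lemma even_part_mult:
  "even_part A\<^sub>0 A\<^sub>1 (mult x y) = mult (even_part A\<^sub>0 A\<^sub>1 x) (even_part A\<^sub>0 A\<^sub>1 y)"
proof -
  let ?a = "even_part A\<^sub>0 A\<^sub>1 x" and ?c = "even_part A\<^sub>0 A\<^sub>1 y"
  let ?b = "x - ?a" and ?d = "y - ?c"
  have "mult x y = mult (?a + ?b) (?c + ?d)" by simp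
  also have "\<dots> = mult ?a ?c + (mult ?a ?d + mult ?b ?c + mult ?b ?d)"
    by (simp only: mult_add_left mult_add_right add.assoc add.commute add.left_commute)
  also have "mult ?b ?d = 0" by (rule odd_odd) (rule odd_part_mem)+
  finally have "mult x y = mult ?a ?c + (mult ?a ?d + mult ?b ?c)" by simp
  moreover have "mult ?a ?d + mult ?b ?c \<in> A\<^sub>1"
    by (intro subspace_add subspace_odd even_odd odd_even even_part_mem odd_part_mem)
  ultimately show ?thesis by (intro even_part_eqI even_even even_part_mem)
qed

lemma even_part_diff: "even_part A\<^sub>0 A\<^sub>1 (x - y) = even_part A\<^sub>0 A\<^sub>1 x - even_part A\<^sub>0 A\<^sub>1 y"
  using even_part_add[of "x - y" y] by simp

lemma even_part_idem: "even_part A\<^sub>0 A\<^sub>1 (even_part A\<^sub>0 A\<^sub>1 x) = even_part A\<^sub>0 A\<^sub>1 x"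
  by (rule even_part_eqI[where b = 0]) (simp_all add: even_part_mem subspace_0 subspace_odd)

lemma odd_mult_odd:
  "mult (x - even_part A\<^sub>0 A\<^sub>1 x) (y - even_part A\<^sub>0 A\<^sub>1 y) = 0"
  by (rule odd_odd) (rule odd_part_mem)+

lemma mult_eq: "mult x y = mult x (even_part A\<^sub>0 A\<^sub>1 y) + mult (even_part A\<^sub>0 A\<^sub>1 x) y
    - mult (even_part A\<^sub>0 A\<^sub>1 x) (even_part A\<^sub>0 A\<^sub>1 y)"
  using odd_mult_odd[of x y] by (simp add: mult_diff_left mult_diff_right algebra_simps)

theorem hu_liu_leibniz_algebra:
  "hu_liu_leibniz_algebra scale (graded_angle mult A\<^sub>0 A\<^sub>1) (commutator mult)"
proof -
  let ?e = "even_part A\<^sub>0 A\<^sub>1"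
    and ?angle = "graded_angle mult A\<^sub>0 A\<^sub>1"
    and ?square = "commutator mult"
  note expand = graded_angle_def commutator_def
    mult_add_left mult_add_right mult_diff_left mult_diff_right
    mult_scale_left mult_scale_right mult_assoc
    even_part_add even_part_diff even_part_scale even_part_mult even_part_idem
    scale_right_diff_distrib
  have square_odd: "?square w y = ?angle w y" if "?e w = 0" for w y
    using mult_eq[of w y] mult_eq[of y w] that mult_diff_left[of 0 0] mult_diff_right[of _ 0 0]
    by (simp add: graded_angle_def commutator_def)
  have defect: "?angle x y - ?angle y x - ?square x y = ?square (?e x) (?e y)" for x y
    using mult_eq[of x y] mult_eq[of y x]
    by (simp add: graded_angle_def commutator_def)
  have square_diff: "?square (a - b - c) z = ?square a z - ?square b z - ?square c z" for a b c z
    by (simp add: expand)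
  have square_skew: "?square a b = - ?square b a" for a b
    by (simp add: commutator_def)
  have angle_angle: "?angle z (?angle x y) = ?square z (?square (?e x) (?e y))" for x y z
    by (simp add: expand)
  show ?thesis
  proof (unfold_locales, goal_cases)
    case (13 x y)
    show ?case by (rule square_odd) (simp add: expand)
  next
    case (15 x y z)
    show ?case
      using defect[of x y] square_diff[of "?angle x y" "?angle y x" "?square x y" z]
        square_skew[of z "?square x y"] square_skew[of z "?angle y x"]
        square_skew[of z "?square (?e x) (?e y)"] angle_angle[of z x y]
      by simp
  qed (simp_all add: expand)
qed

end

end

theory Submission
  imports Defs
begin

text \<open>Write \<open>R\<^sub>y\<close> for the right multiplication \<open>x \<mapsto> \<langle>x, y\<rangle>\<close>. In a graded algebra, an element \<open>y\<close> of
  the even part satisfies \<open>[z, y] = \<langle>z, y\<rangle>\<close> for all \<open>z\<close>, which suggests to look at the subspace \<open>E\<close>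
  of all such elements of \<open>L\<close> (\<open>agreement_space\<close>). Two facts about \<open>E\<close> hold in every Hu-Liu Leibniz
  algebra. Firstly, every \<open>R\<^sub>y\<close> is a derivation of both brackets, hence maps \<open>E\<close> into itself.
  Secondly, \<open>E\<close> contains every defect \<open>[x, y] - \<langle>x, y\<rangle> + \<langle>y, x\<rangle>\<close>, by the fourth
  axiom. So \<open>L / E\<close> is a module over the operators that preserve \<open>E\<close>, and modulo \<open>E\<close> the square
  bracket is the skew-symmetrised angle bracket, just as in the odd part of a graded algebra.

  Let \<open>A\<^sub>0\<close> be the algebra of linear operators preserving \<open>E\<close>, multiplied in the order of right
  operators, and let \<open>A\<^sub>1 = L / E\<close> be a right \<open>A\<^sub>0\<close>-module on which \<open>A\<^sub>0\<close> acts by zero from the left.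
  Then \<open>x \<mapsto> (R\<^sub>x, x + E)\<close> is a homomorphism into \<open>A\<^sub>0 \<oplus> A\<^sub>1\<close>: the Leibniz identity says that
  \<open>x \<mapsto> R\<^sub>x\<close> turns the angle bracket into the commutator, the first axiom says that \<open>[x, y]\<close> and
  \<open>\<langle>x, y\<rangle>\<close> have the same right multiplication, and in \<open>L / E\<close> the defects vanish. The kernel is the
  set \<open>Z\<close> of all \<open>x\<close> with \<open>\<langle>L, x\<rangle> = 0\<close> and \<open>[L, x] = 0\<close>. This \<open>Z\<close> is an ideal (\<open>right_kernel_ideal\<close>), so by simplicity
  it is \<open>0\<close> unless it contains \<open>L\<^sup>a\<^sup>n\<^sup>n\<close>, and the latter would mean \<open>[L\<^sup>a\<^sup>n\<^sup>n, L] = 0\<close>.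

  To carry the algebra by the whole type of pairs of a function and a vector, products are formed
  after applying linear projections: \<open>P\<close> from all functions onto the operators that preserve \<open>E\<close>,
  and \<open>p\<close> with kernel \<open>E\<close>, whose image stands for \<open>L / E\<close>. What \<open>P\<close> kills and what lies in
  the kernel of \<open>p\<close> merely enlarge the even and the odd part.\<close>

section \<open>Projections onto subspaces\<close>

lemma (in vector_space) exists_projection:
  assumes "subspace V"
  obtains P where "Vector_Spaces.linear scale scale P" "\<And>x. P x \<in> V" "\<And>x. x \<in> V \<Longrightarrow> P x = x"
proof -
  interpret vector_space_pair scale scale by unfold_locales
  have "Vector_Spaces.linear scale scale (\<lambda>x. x)"
    using linear_id unfolding id_def .
  from linear_exists_left_inverse_on[OF this assms]
  show ?thesis using that by (auto simp: image_subset_iff)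
qed

section \<open>A graded algebra of operators and vectors\<close>

definition operator_scale :: "('k \<Rightarrow> 'a \<Rightarrow> 'a) \<Rightarrow> 'k \<Rightarrow> ('a \<Rightarrow> 'a) \<Rightarrow> 'a \<Rightarrow> 'a" where
  "operator_scale scale c f = (\<lambda>x. scale c (f x))"

definition extension_scale ::
    "('k \<Rightarrow> 'a \<Rightarrow> 'a) \<Rightarrow> 'k \<Rightarrow> ('a \<Rightarrow> 'a) \<times> 'a \<Rightarrow> ('a \<Rightarrow> 'a) \<times> 'a" where
  "extension_scale scale c u = (operator_scale scale c (fst u), scale c (snd u))"

text \<open>Operators act on vectors from the right, which is why the first components are composed in
  reverse order; the left action of operators on vectors is zero. The projection \<open>P\<close> makes sense of
  a function as an operator, and applying \<open>p\<close> amounts to computing modulo its kernel.\<close>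

definition extension_mult ::
    "(('a \<Rightarrow> 'a) \<Rightarrow> 'a \<Rightarrow> 'a) \<Rightarrow> ('a \<Rightarrow> 'a) \<Rightarrow> ('a \<Rightarrow> 'a) \<times> 'a \<Rightarrow> ('a \<Rightarrow> 'a) \<times> 'a \<Rightarrow> ('a \<Rightarrow> 'a) \<times> 'a" where
  "extension_mult P p u v = (P (fst v) \<circ> P (fst u), p (P (fst v) (snd u)))"

abbreviation (input) even_extension :: "(('a \<Rightarrow> 'a) \<times> 'a::zero) set" where
  "even_extension \<equiv> UNIV \<times> {0}"

abbreviation (input) odd_extension :: "(('a \<Rightarrow> 'a::zero) \<times> 'a) set" where
  "odd_extension \<equiv> {0} \<times> UNIV"

context vector_space
begin

lemma vector_space_operators: "vector_space (operator_scale scale)"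
  by unfold_locales (simp_all add: operator_scale_def fun_eq_iff algebra_simps)

text \<open>The last assumption says that the operators respect congruence modulo the kernel of \<open>p\<close>;
  together with the closure of the operators under composition it gives associativity.\<close>

lemma special_Z2_graded_extension:
  assumes P: "Vector_Spaces.linear (operator_scale scale) (operator_scale scale) P"
    and P_linear: "\<And>f. Vector_Spaces.linear scale scale (P f)"
    and P_comp: "\<And>f g. P (P g \<circ> P f) = P g \<circ> P f"
    and p: "Vector_Spaces.linear scale scale p"
    and p_P: "\<And>f x. p (P f (p x)) = p (P f x)"
  shows "special_Z2_graded_algebra (extension_scale scale) (extension_mult P p)
    even_extension odd_extension"
proof -
  interpret ext: vector_space "extension_scale scale"
    by unfold_locales
      (simp_all add: extension_scale_def operator_scale_def prod_eq_iff fun_eq_iff algebra_simps)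
  note P_hom = P[folded module_hom_iff_linear]
    and Pf_hom = P_linear[folded module_hom_iff_linear]
    and p_hom = p[folded module_hom_iff_linear]
  note hom_simps = module_hom.add[OF P_hom] module_hom.scale[OF P_hom] module_hom.zero[OF P_hom]
    module_hom.add[OF Pf_hom] module_hom.scale[OF Pf_hom] module_hom.zero[OF Pf_hom]
    module_hom.add[OF p_hom] module_hom.scale[OF p_hom] module_hom.zero[OF p_hom]
  have operator_scale_apply: "operator_scale scale c f x = scale c (f x)" for c f x
    by (simp add: operator_scale_def)
  note simps = extension_mult_def extension_scale_def operator_scale_apply hom_simps prod_eq_iff
    fun_eq_iff
  show ?thesis
  proof (unfold_locales, goal_cases)
    case (5 x y z)
    \<comment> \<open>associativity: both products have the second component \<open>p (P h (P g x))\<close>, where \<open>x\<close> is the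
      vector of the first factor and \<open>g\<close>, \<open>h\<close> are the functions of the other two\<close>
    show ?case by (simp add: extension_mult_def P_comp p_P comp_assoc)
  next
    case 6
    show ?case by (auto simp: zero_prod_def ext.subspace_def extension_scale_def)
  next
    case 7
    show ?case
      by (auto simp: zero_prod_def ext.subspace_def extension_scale_def operator_scale_def
          fun_eq_iff)
  next
    case (9 x)
    show ?case by (auto simp: prod_eq_iff)
  qed (auto simp: simps)
qed

end

section \<open>Elements on which the two brackets agree\<close>

context hu_liu_leibniz_algebra
begin

lemma angle_zero: "angle 0 x = 0" "angle x 0 = 0"
  using mult_diff_left[of 0 0 x] mult_diff_right[of x 0 0] by simp_all

lemma square_zero: "square x 0 = 0"
  using lie.mult_diff_right[of x 0 0] by simp

definition agreement_space :: "'a set" where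
  "agreement_space = {x. \<forall>z. square z x = angle z x}"

lemma subspace_agreement_space: "subspace agreement_space"
  by (auto simp: angle_zero square_zero subspace_def agreement_space_def
      lie.mult_add_right mult_add_right lie.mult_scale_right mult_scale_right)

lemma square_skew: "square x y = - square y x"
proof -
  have "square x y + square y x = 0"
    using lie.alternating[of "x + y"] unfolding lie.mult_add_left lie.mult_add_right
    by (simp add: lie.alternating add.commute)
  then show ?thesis by (simp add: eq_neg_iff_add_eq_0)
qed

text \<open>Up to skew-symmetry this is the third axiom; the analogous statement for the angle bracket
  is the Leibniz identity.\<close>

lemma right_mult_derivation:
  "angle (square x y) z = square (angle x z) y + square x (angle y z)"
  using hu_liu_3[of x y z] square_skew[of "angle y z" x] square_skew[of y "angle x z"]
  by (simp add: algebra_simps)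

text \<open>Applying the derivation \<open>\<langle>_, y\<rangle>\<close> to \<open>[z, x] = \<langle>z, x\<rangle>\<close> gives an equation in which the terms
  with \<open>\<langle>z, y\<rangle>\<close> and \<open>x\<close> cancel.\<close>

lemma angle_agreement_space:
  assumes "x \<in> agreement_space"
  shows "angle x y \<in> agreement_space"
proof -
  have "square z (angle x y) = angle z (angle x y)" for z
    using right_mult_derivation[of z x y] assms
    by (simp add: agreement_space_def leibniz_identity[of z x y])
  then show ?thesis by (simp add: agreement_space_def)
qed

lemma angle_angle_skew: "angle z (angle x y) + angle z (angle y x) = 0"
proof -
  have "angle z (angle u v) = angle (angle z u) v - angle (angle z v) u" for u v
    by (simp add: leibniz_identity[of z u v])
  then show ?thesis by simp
qed

text \<open>Both brackets of \<open>z\<close> with the defect equal \<open>- \<langle>z, \<langle>x, y\<rangle>\<rangle>\<close>: the square bracket by the fourth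
  axiom, the angle bracket by the first axiom and the skew-symmetry just shown. The defect is what
  must vanish in the odd part of a graded algebra, so it has to be factored out there.\<close>

lemma defect_agreement_space: "square x y - angle x y + angle y x \<in> agreement_space"
proof -
  let ?d = "square x y - angle x y + angle y x"
  have "square z ?d = angle z ?d" for z
  proof -
    have "square z ?d + angle z (angle x y) = 0"
      using hu_liu_4[of x y z]
      unfolding square_skew[of "angle x y" z] lie.mult_add_right lie.mult_diff_right
      by (simp add: algebra_simps)
    moreover have "angle z ?d = angle z (angle y x)"
      by (simp add: mult_add_right mult_diff_right hu_liu_1)
    ultimately show ?thesis
      using angle_angle_skew[of z x y] by (metis add.commute add_left_cancel)
  qed
  then show ?thesis by (simp add: agreement_space_def)
qed

section \<open>The common right kernel of the two brackets\<close>

definition right_kernel :: "'a set" where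
  "right_kernel = {x. \<forall>z. angle z x = 0 \<and> square z x = 0}"

text \<open>Closure under \<open>a \<mapsto> \<langle>a, x\<rangle>\<close> holds because right multiplications are derivations of both
  brackets; \<open>\<langle>x, a\<rangle>\<close> and \<open>[x, a]\<close> vanish.\<close>

lemma right_kernel_ideal: "hu_liu_ideal right_kernel"
proof -
  have "subspace right_kernel"
    by (auto simp: angle_zero square_zero subspace_def right_kernel_def
        lie.mult_add_right mult_add_right lie.mult_scale_right mult_scale_right)
  moreover have "angle a x \<in> right_kernel" if "a \<in> right_kernel" for a x
  proof -
    have a: "angle z a = 0" "square z a = 0" for z
      using that by (simp_all add: right_kernel_def)
    have "angle z (angle a x) = 0" for z
      using leibniz_identity[of z a x] a by (simp add: angle_zero)
    moreover have "square z (angle a x) = 0" for z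
      using right_mult_derivation[of z a x] a by (simp add: angle_zero)
    ultimately show ?thesis by (simp add: right_kernel_def)
  qed
  moreover have "0 \<in> right_kernel"
    by (simp add: right_kernel_def angle_zero square_zero)
  ultimately show ?thesis
    by (simp add: hu_liu_ideal_def) (simp add: right_kernel_def)
qed

section \<open>Embedding into a graded algebra\<close>

text \<open>The homomorphism sends \<open>x\<close> to its right multiplication and its class modulo the agreement
  space. If both vanish then \<open>\<langle>z, x\<rangle> = 0\<close> and \<open>[z, x] = \<langle>z, x\<rangle>\<close> for all \<open>z\<close>, so \<open>x\<close> lies in the
  common right kernel.\<close>

proposition linear_if_right_kernel_trivial:
  assumes "right_kernel = {0}"
  shows "\<exists>(scale\<^sub>A :: 'k \<Rightarrow> ('a \<Rightarrow> 'a) \<times> 'a \<Rightarrow> ('a \<Rightarrow> 'a) \<times> 'a) mult A\<^sub>0 A\<^sub>1 \<phi>.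
    special_Z2_graded_algebra scale\<^sub>A mult A\<^sub>0 A\<^sub>1 \<and>
    hu_liu_homomorphism scale angle square
      scale\<^sub>A (graded_angle mult A\<^sub>0 A\<^sub>1) (commutator mult) \<phi> \<and>
    inj \<phi>"
proof -
  let ?E = agreement_space
  define V where "V = {f. Vector_Spaces.linear scale scale f \<and> f ` ?E \<subseteq> ?E}"
  interpret pair: vector_space_pair scale scale by unfold_locales
  interpret ops: vector_space "operator_scale scale" by (rule vector_space_operators)

  obtain q where q: "Vector_Spaces.linear scale scale q"
      "\<And>x. q x \<in> ?E" "\<And>x. x \<in> ?E \<Longrightarrow> q x = x"
    using exists_projection[OF subspace_agreement_space] by blast
  \<comment> \<open>The complementary projection has kernel \<open>E\<close>.\<close>
  define p where "p x = x - q x" for x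
  have p: "Vector_Spaces.linear scale scale p"
    unfolding p_def using linear_id q(1) unfolding id_def by (rule pair.linear_compose_sub)
  note p_hom = p[folded module_hom_iff_linear]
  have p_eq_0_iff: "p x = 0 \<longleftrightarrow> x \<in> ?E" for x
    using q(2)[of x] q(3)[of x] by (auto simp: p_def)

  have "ops.subspace V"
    unfolding ops.subspace_def V_def operator_scale_def
    using subspace_agreement_space
    by (auto simp: subspace_0 zero_fun_def plus_fun_def image_subset_iff
        intro!: pair.linear_zero pair.linear_compose_add pair.linear_compose_scale_right
          subspace_add subspace_scale)
  then obtain P where P: "Vector_Spaces.linear (operator_scale scale) (operator_scale scale) P"
      "\<And>f. P f \<in> V" "\<And>f. f \<in> V \<Longrightarrow> P f = f"
    using ops.exists_projection by blast
  have P_linear: "Vector_Spaces.linear scale scale (P f)"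
    and P_invariant: "x \<in> ?E \<Longrightarrow> P f x \<in> ?E" for f x
    using P(2)[of f] by (auto simp: V_def)
  have "P (P g \<circ> P f) = P g \<circ> P f" for f g
    using Vector_Spaces.linear_compose[OF P_linear P_linear] P_invariant
    by (intro P(3)) (auto simp: V_def)
  moreover have "p (f (p x)) = p (f x)" if "f \<in> V" for f x
  proof -
    have f: "module_hom scale scale f" "q x \<in> ?E \<Longrightarrow> f (q x) \<in> ?E"
      using that by (auto simp: V_def module_hom_iff_linear)
    have "p (f (p x)) = p (f x) - p (f (q x))"
      unfolding p_def[of x] by (simp add: module_hom.diff[OF f(1)] module_hom.diff[OF p_hom])
    then show ?thesis using f(2) q(2) p_eq_0_iff by simp
  qed
  note p_absorb = this
  ultimately interpret A: special_Z2_graded_algebra "extension_scale scale" "extension_mult P p"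
      even_extension odd_extension
    using P p P_linear by (intro special_Z2_graded_extension) auto

  have even_part: "even_part even_extension odd_extension u = (fst u, 0)"
    for u :: "('a \<Rightarrow> 'a) \<times> 'a"
    by (rule A.even_part_eqI[where b = "(0, snd u)"]) (simp_all add: prod_eq_iff)

  define R where "R y = (\<lambda>x. angle x y)" for y
  have R_in_V: "R y \<in> V" for y
    unfolding V_def R_def using linear_left angle_agreement_space by auto
  note P_R = P(3)[OF R_in_V]
  define \<phi> where "\<phi> x = (R x, p x)" for x
  have R_angle: "R (angle x y) = (R y \<circ> R x) - (R x \<circ> R y)" for x y
    by (simp add: R_def fun_eq_iff leibniz_identity[of _ x y])
  have p_R: "p (R y (p x)) = p (angle x y)" for x y
    using p_absorb[OF R_in_V[of y]] by (simp add: R_def)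
  have R_0: "R y 0 = 0" for y
    by (simp add: R_def angle_zero)
  have p_0: "p 0 = 0"
    by (rule module_hom.zero[OF p_hom])

  have "hu_liu_homomorphism scale angle square (extension_scale scale)
      (graded_angle (extension_mult P p) even_extension odd_extension)
      (commutator (extension_mult P p)) \<phi>"
  proof -
    interpret target: hu_liu_leibniz_algebra "extension_scale scale"
      "graded_angle (extension_mult P p) even_extension odd_extension"
      "commutator (extension_mult P p)"
      by (rule A.hu_liu_leibniz_algebra)
    show ?thesis
    proof (unfold_locales, goal_cases)
      case (1 x y)
      show ?case
        by (simp add: \<phi>_def R_def fun_eq_iff mult_add_right module_hom.add[OF p_hom])
    next
      case (2 c x)
      show ?case
        by (simp add: \<phi>_def R_def fun_eq_iff mult_scale_right module_hom.scale[OF p_hom]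
            extension_scale_def operator_scale_def)
    next
      case (3 x y)
      show ?case
        by (simp add: \<phi>_def graded_angle_def even_part extension_mult_def P_R p_R R_angle
            R_0 p_0 prod_eq_iff)
    next
      case (4 x y)
      \<comment> \<open>the commutator of \<open>\<phi> x\<close> and \<open>\<phi> y\<close> has the odd part \<open>p \<langle>x, y\<rangle> - p \<langle>y, x\<rangle>\<close>, as operators act
        by zero from the left\<close>
      have "R (square x y) = R (angle x y)"
        using hu_liu_1 by (simp add: R_def)
      moreover have "p (square x y) = p (angle x y) - p (angle y x)"
      proof -
        have "p (square x y - angle x y + angle y x) = 0"
          using defect_agreement_space p_eq_0_iff by simp
        then show ?thesis
          by (simp add: module_hom.add[OF p_hom] module_hom.diff[OF p_hom] algebra_simps
              add_eq_0_iff eq_neg_iff_add_eq_0)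
      qed
      ultimately show ?case
        by (simp add: \<phi>_def commutator_def extension_mult_def P_R p_R R_angle prod_eq_iff)
    qed
  qed
  moreover have "inj \<phi>"
  proof (rule injI)
    fix x y assume "\<phi> x = \<phi> y"
    then have "angle z x = angle z y" and "p (x - y) = 0" for z
      by (simp_all add: \<phi>_def R_def fun_eq_iff module_hom.diff[OF p_hom])
    then have "x - y \<in> right_kernel"
      unfolding right_kernel_def p_eq_0_iff agreement_space_def by (simp add: mult_diff_right)
    then show "x = y" using assms by simp
  qed
  ultimately show ?thesis
    using A.special_Z2_graded_algebra_axioms by blast
qed

end

section \<open>Simple algebras\<close>

text \<open>The common right kernel is an ideal, and a nonzero ideal contains the annihilator; but the
  annihilator cannot lie in it, as it has a nonzero square bracket with the algebra.\<close>

lemma (in simple_hu_liu_leibniz_algebra) right_kernel_trivial: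
  assumes "square_product annihilator UNIV \<noteq> {0}"
  shows "right_kernel = {0}"
proof (rule ccontr)
  assume "right_kernel \<noteq> {0}"
  then have "annihilator \<subseteq> right_kernel"
    using ideals_trivial[OF right_kernel_ideal] by auto
  then have "square a x = 0" if "a \<in> annihilator" for a x
    using that square_skew[of a x] by (auto simp: right_kernel_def)
  then have "{square u v | u v. u \<in> annihilator \<and> v \<in> UNIV} \<subseteq> {0}"
    by auto
  then have "square_product annihilator UNIV \<subseteq> {0}"
    unfolding square_product_def using subspace_single_0 by (rule span_minimal)
  then show False
    using assms span_zero unfolding square_product_def by blast
qed

theorem proposition2p2:
  fixes scale :: "'k::field \<Rightarrow> 'a::ab_group_add \<Rightarrow> 'a"
    and angle square :: "'a \<Rightarrow> 'a \<Rightarrow> 'a"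
  assumes "simple_hu_liu_leibniz_algebra scale angle square"
    and "hu_liu_leibniz_algebra.square_product scale square
           (right_leibniz_algebra.annihilator scale angle) UNIV \<noteq> {0}"
  shows "\<exists>(scale\<^sub>A :: 'k \<Rightarrow> ('a \<Rightarrow> 'a) \<times> 'a \<Rightarrow> ('a \<Rightarrow> 'a) \<times> 'a) mult A\<^sub>0 A\<^sub>1 \<phi>.
           special_Z2_graded_algebra scale\<^sub>A mult A\<^sub>0 A\<^sub>1 \<and>
           hu_liu_homomorphism scale angle square
             scale\<^sub>A (graded_angle mult A\<^sub>0 A\<^sub>1) (commutator mult) \<phi> \<and>
           inj \<phi>"
proof -
  interpret simple_hu_liu_leibniz_algebra scale angle square by (rule assms(1))
  show ?thesis
    by (rule linear_if_right_kernel_trivial) (rule right_kernel_trivial[OF assms(2)])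
qed

end
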